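(* Let $H\in\mathbb{H}^n_+$, let $\Omega\in\mathbb{R}^{n\times r}$ be a test matrix of full rank, $r\le n$, and assume that $H\Omega$ has full rank. Let $$H^{\mathrm{Nys}}\langle\Omega\rangle=(H\Omega)(\Omega^*H\Omega)^+(H\Omega)^*$$ be the Nyström approximation of $H$. Then $H^{\mathrm{Nys}}\langle\Omega\rangle$ is a minimiser of the optimisation problem $$\begin{aligned}\text{minimise over } W\in\mathbb{H}^n_+\quad & \mathcal{D}_{\mathrm{LD}}(\Omega^*W\Omega,\Omega^*H\Omega)\\ \text{subject to}\quad & \operatorname{range}W\subseteq\operatorname{range}H\Omega.\end{aligned}$$
   Context: $\mathbb{H}^n_+$ denotes the cone of Hermitian positive semidefinite $n\times n$ matrices, $M^*$ the conjugate transpose and $M^+$ the Moore–Penrose inverse. For Hermitian positive definite $r\times r$ matrices $X,Y$, the Bregman log determinant divergence is $$\mathcal{D}_{\mathrm{LD}}(X,Y)=\operatorname{trace}(XY^{-1})-\log\det(XY^{-1})-r;$$ for $Y$ positive definite and $X$ positive semidefinite but singular its value is $+\infty$. *)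

theory Defs
  imports "HOL-Analysis.Analysis"
begin

definition conj_transpose :: "complex^'n^'m \<Rightarrow> complex^'m^'n" where
  "conj_transpose A = (\<chi> i j. cnj (A $ j $ i))"

abbreviation complex_matrix :: "real^'n^'m \<Rightarrow> complex^'n^'m" where
  "complex_matrix \<equiv> map_matrix complex_of_real"

definition hermitian :: "complex^'n^'n \<Rightarrow> bool" where
  "hermitian A \<longleftrightarrow> conj_transpose A = A"

(* The form x* A x; it is real for Hermitian A, so that taking Re below loses nothing. *)
definition quad_form :: "complex^'n^'n \<Rightarrow> complex^'n \<Rightarrow> complex" where
  "quad_form A x = (\<Sum>i\<in>UNIV. cnj (x $ i) * (A *v x) $ i)"

definition psd_cone :: "(complex^'n^'n) set" where
  "psd_cone = {A. hermitian A \<and> (\<forall>x. 0 \<le> Re (quad_form A x))}"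

definition pos_def :: "complex^'n^'n \<Rightarrow> bool" where
  "pos_def A \<longleftrightarrow> hermitian A \<and> (\<forall>x. x \<noteq> 0 \<longrightarrow> 0 < Re (quad_form A x))"

definition full_rank :: "'a::field^'n^'m \<Rightarrow> bool" where
  "full_rank A \<longleftrightarrow> rank A = min CARD('m) CARD('n)"

definition is_pinv :: "complex^'n^'m \<Rightarrow> complex^'m^'n \<Rightarrow> bool" where
  "is_pinv A X \<longleftrightarrow>
     A ** X ** A = A \<and> X ** A ** X = X \<and> hermitian (A ** X) \<and> hermitian (X ** A)"

definition pinv :: "complex^'n^'m \<Rightarrow> complex^'m^'n" where
  "pinv A = (THE X. is_pinv A X)"

definition nystrom :: "complex^'n^'n \<Rightarrow> complex^'r^'n \<Rightarrow> complex^'n^'n" where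
  "nystrom H \<Omega> =
     (H ** \<Omega>) ** pinv (conj_transpose \<Omega> ** H ** \<Omega>) ** conj_transpose (H ** \<Omega>)"

(* Meant for positive definite Y and positive semidefinite X; the second branch is then
   exactly the case of singular X. In the first branch X Y^{-1} is similar to a positive
   definite matrix, so its trace is real and its determinant is real and positive. *)
definition ld_div :: "complex^'r^'r \<Rightarrow> complex^'r^'r \<Rightarrow> ereal" where
  "ld_div X Y =
     (if pos_def X
      then ereal (Re (trace (X ** matrix_inv Y)) - ln (Re (det (X ** matrix_inv Y)))
                  - real CARD('r))
      else \<infinity>)"

lemma conj_transpose_mult:
  "conj_transpose (A ** B) = conj_transpose B ** conj_transpose A"
  by (simp add: conj_transpose_def matrix_matrix_mult_def vec_eq_iff mult.commute)

lemma is_pinv_unique: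
  assumes X: "is_pinv A X" and Y: "is_pinv A Y"
  shows "X = Y"
proof -
  have hX: "conj_transpose X ** conj_transpose A = A ** X"
      "conj_transpose A ** conj_transpose X = X ** A"
    and hY: "conj_transpose Y ** conj_transpose A = A ** Y"
      "conj_transpose A ** conj_transpose Y = Y ** A"
    using X Y by (simp_all add: is_pinv_def hermitian_def conj_transpose_mult)
  have eX: "A ** X ** A = A" "X ** A ** X = X" and eY: "A ** Y ** A = A" "Y ** A ** Y = Y"
    using X Y by (simp_all add: is_pinv_def)
  have "A ** X = conj_transpose X ** conj_transpose (A ** Y ** A)"
    by (simp add: eY hX)
  also have "\<dots> = (conj_transpose X ** conj_transpose A) ** (conj_transpose Y ** conj_transpose A)"
    by (simp add: conj_transpose_mult matrix_mul_assoc)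
  also have "\<dots> = (A ** X ** A) ** Y"
    unfolding hX hY by (simp add: matrix_mul_assoc)
  finally have 1: "A ** X = A ** Y"
    by (simp add: eX)
  have "X ** A = conj_transpose (A ** Y ** A) ** conj_transpose X"
    by (simp add: eY hX)
  also have "\<dots> = (conj_transpose A ** conj_transpose Y) ** (conj_transpose A ** conj_transpose X)"
    by (simp add: conj_transpose_mult matrix_mul_assoc)
  also have "\<dots> = Y ** (A ** X ** A)"
    unfolding hX hY by (simp add: matrix_mul_assoc)
  finally have 2: "X ** A = Y ** A"
    by (simp add: eX)
  have "X = X ** (A ** X)"
    by (simp add: eX matrix_mul_assoc)
  also have "\<dots> = Y ** A ** Y"
    by (simp add: 1 2 matrix_mul_assoc)
  finally show ?thesis
    by (simp add: eY)
qed

lemma pinv_eqI: "is_pinv A X \<Longrightarrow> pinv A = X"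
  unfolding pinv_def by (blast intro: the_equality is_pinv_unique)

end

theory Submission
  imports Defs
begin

text \<open>
  The divergence of two positive definite matrices is nonnegative and vanishes when they are equal;
  a first argument outside the positive definite matrices gives \<open>\<infinity>\<close>. So a feasible \<open>W\<close> attains the
  minimum, which is \<open>0\<close>, as soon as \<open>\<Omega>\<^sup>* W \<Omega> = M\<close>, where \<open>M = \<Omega>\<^sup>* H \<Omega>\<close>. The Nystroem approximation
  has this property: since \<open>M\<close> is invertible, its pseudoinverse is its inverse and the compression
  is \<open>M M\<^sup>-\<^sup>1 M = M\<close>.

  \<open>M\<close> is positive definite because a positive semidefinite form vanishes at a vector only if the
  matrix annihilates the vector (\<open>psd_isotropic_kernel\<close>): from \<open>x\<^sup>* M x = 0\<close> one gets \<open>H \<Omega> x = 0\<close>,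
  and the columns of \<open>H \<Omega>\<close> are independent.

  The substance is the nonnegativity \<open>ld_div_nonneg\<close>. If \<open>X Y\<^sup>-\<^sup>1\<close> is similar to a diagonal matrix with
  positive entries \<open>l\<^sub>i\<close>, the divergence is the sum of the numbers \<open>l\<^sub>i - ln l\<^sub>i - 1 \<ge> 0\<close>. The
  similarity comes from a basis of vectors \<open>v\<^sub>i\<close> with \<open>X v\<^sub>i = l\<^sub>i Y v\<^sub>i\<close> that is orthonormal for the form
  of \<open>Y\<close>. Such a basis is built one vector at a time (\<open>generalised_eigenvectors\<close>), each one
  minimising the Rayleigh quotient \<open>x\<^sup>* X x / x\<^sup>* Y x\<close> over the vectors that are \<open>Y\<close>-orthogonal to
  those already found.
\<close>

section \<open>The Hermitian inner product and quadratic forms\<close>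

definition cdot :: "complex^'n \<Rightarrow> complex^'n \<Rightarrow> complex" where
  "cdot x y = (\<Sum>i\<in>UNIV. cnj (x $ i) * y $ i)"

lemma quad_form_cdot: "quad_form A x = cdot x (A *v x)"
  by (simp add: quad_form_def cdot_def)

lemma cdot_linear:
  "cdot x (y + z) = cdot x y + cdot x z" "cdot x (y - z) = cdot x y - cdot x z"
  "cdot (x + y) z = cdot x z + cdot y z" "cdot (x - y) z = cdot x z - cdot y z"
  "cdot x (c *s y) = c * cdot x y" "cdot (c *s x) y = cnj c * cdot x y"
  "cdot x 0 = 0" "cdot 0 y = 0"
  by (simp_all add: cdot_def algebra_simps sum.distrib sum_subtractf sum_distrib_left)

lemma cdot_cnj: "cnj (cdot x y) = cdot y x"
  by (simp add: cdot_def mult.commute)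

lemma cdot_adjoint: "cdot (A *v x) y = cdot x (conj_transpose A *v y)"
proof -
  have "cdot (A *v x) y = (\<Sum>i\<in>UNIV. \<Sum>j\<in>UNIV. cnj (x $ j) * (cnj (A $ i $ j) * y $ i))"
    by (simp add: cdot_def matrix_vector_mult_def sum_distrib_left mult_ac)
  also have "\<dots> = cdot x (conj_transpose A *v y)"
    by (subst sum.swap) (simp add: cdot_def matrix_vector_mult_def conj_transpose_def sum_distrib_left)
  finally show ?thesis .
qed

lemma conj_transpose_conj_transpose [simp]: "conj_transpose (conj_transpose A) = A"
  by (simp add: conj_transpose_def vec_eq_iff)

lemma conj_transpose_mat_1 [simp]: "conj_transpose (mat 1) = mat 1"
  by (auto simp add: conj_transpose_def vec_eq_iff mat_def)

lemma cdot_hermitian: "hermitian A \<Longrightarrow> cdot (A *v x) y = cdot x (A *v y)"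
  by (simp add: cdot_adjoint hermitian_def)

lemma cdot_self: "cdot x x = of_real (\<Sum>i\<in>UNIV. (cmod (x $ i))\<^sup>2)"
  by (simp add: cdot_def complex_norm_square mult.commute del: of_real_power)

lemma cdot_self_eq_0: "cdot x x = 0 \<longleftrightarrow> x = 0"
proof -
  have "cdot x x = 0 \<longleftrightarrow> (\<Sum>i\<in>UNIV. (cmod (x $ i))\<^sup>2) = 0"
    unfolding cdot_self by (simp only: of_real_eq_0_iff)
  also have "\<dots> \<longleftrightarrow> x = 0"
    by (simp add: sum_nonneg_eq_0_iff vec_eq_iff)
  finally show ?thesis .
qed

lemma quad_form_real: "hermitian A \<Longrightarrow> quad_form A x = of_real (Re (quad_form A x))"
  using cdot_cnj[of x "A *v x"]
  by (simp add: quad_form_cdot cdot_hermitian complex_eq_iff)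

lemma quad_form_congruence:
  "quad_form (conj_transpose B ** A ** B) x = quad_form A (B *v x)"
  by (simp add: quad_form_cdot cdot_adjoint matrix_vector_mul_assoc matrix_mul_assoc)

lemma hermitian_congruence: "hermitian A \<Longrightarrow> hermitian (conj_transpose B ** A ** B)"
  by (simp add: hermitian_def conj_transpose_mult matrix_mul_assoc)

lemma quad_form_scale: "quad_form A (c *s x) = of_real ((cmod c)\<^sup>2) * quad_form A x"
  by (simp add: quad_form_cdot vec.scale cdot_linear complex_norm_square mult_ac del: of_real_power)

lemma quad_form_diff: "quad_form (A - t *\<^sub>R B) x = quad_form A x - of_real t * quad_form B x"
proof -
  have "(A - t *\<^sub>R B) *v x = A *v x - of_real t *s (B *v x)"
    by (simp add: vec_eq_iff matrix_vector_mult_def scaleR_conv_of_real[where 'a = complex] sum_subtractf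
        sum_distrib_left algebra_simps)
  then show ?thesis
    by (simp add: quad_form_cdot cdot_linear)
qed

lemma hermitian_diff: "hermitian A \<Longrightarrow> hermitian B \<Longrightarrow> hermitian (A - t *\<^sub>R B)"
  by (simp add: hermitian_def conj_transpose_def vec_eq_iff)

section \<open>Inverses of positive definite matrices\<close>

lemma pos_def_invertible:
  assumes "pos_def Y" shows "invertible Y"
proof -
  have "\<forall>x. Y *v x = 0 \<longrightarrow> x = 0"
    using assms by (force simp: pos_def_def quad_form_cdot cdot_linear)
  then show ?thesis by (simp add: invertible_left_inverse matrix_left_invertible_ker)
qed

lemma matrix_inv_mult:
  assumes "invertible (A :: complex^'n^'n)"
  shows "A ** matrix_inv A = mat 1" "matrix_inv A ** A = mat 1"
  using assms unfolding invertible_def matrix_inv_def by (metis (mono_tags, lifting) someI_ex)+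

lemma hermitian_matrix_inv:
  assumes "hermitian A" "invertible A"
  shows "hermitian (matrix_inv A)"
proof -
  have "conj_transpose (matrix_inv A) ** A = mat 1"
    using assms by (metis conj_transpose_mult conj_transpose_mat_1 hermitian_def matrix_inv_mult(1))
  then show ?thesis
    unfolding hermitian_def using assms(2)
    by (metis matrix_inv_mult(1) matrix_mul_assoc matrix_mul_lid matrix_mul_rid)
qed

text \<open>The inverse is congruent to the matrix itself: \<open>A\<^sup>-\<^sup>1 = (A\<^sup>-\<^sup>1)\<^sup>* A A\<^sup>-\<^sup>1\<close>.\<close>

lemma psd_cone_matrix_inv:
  assumes "pos_def A" shows "matrix_inv A \<in> psd_cone"
proof -
  have "0 \<le> Re (quad_form A x)" for x
    using assms by (cases "x = 0") (auto simp: pos_def_def quad_form_cdot cdot_linear intro: less_imp_le)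
  then have A: "A \<in> psd_cone" using assms by (simp add: pos_def_def psd_cone_def)
  have inv: "invertible A" by (rule pos_def_invertible[OF assms])
  have h: "hermitian (matrix_inv A)"
    using assms inv by (simp add: hermitian_matrix_inv pos_def_def)
  then have "matrix_inv A = conj_transpose (matrix_inv A) ** A ** matrix_inv A"
    by (simp add: hermitian_def matrix_inv_mult[OF inv])
  then have "quad_form (matrix_inv A) x = quad_form A (matrix_inv A *v x)" for x
    by (metis quad_form_congruence)
  then show ?thesis using A h by (simp add: psd_cone_def)
qed

lemma psd_cone_congruence:
  assumes "A \<in> psd_cone" shows "conj_transpose B ** A ** B \<in> psd_cone"
  using assms by (simp add: psd_cone_def hermitian_congruence quad_form_congruence)

section \<open>Isotropic vectors of a nonnegative form\<close>

text \<open>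
  At an isotropic vector \<open>v\<close> a nonnegative form is minimal, so its first variation vanishes in every
  direction \<open>w\<close> of the subspace. This serves twice: with the whole space it describes the kernel
  of a positive semidefinite matrix, and with a proper subspace it is the first-order condition
  for a minimal Rayleigh quotient.
\<close>

lemma isotropic_vector_orthogonal:
  assumes A: "hermitian A" and S: "vec.subspace S"
    and nonneg: "\<And>x. x \<in> S \<Longrightarrow> 0 \<le> Re (quad_form A x)"
    and v: "v \<in> S" "Re (quad_form A v) = 0" and w: "w \<in> S"
  shows "cdot w (A *v v) = 0"
proof (rule ccontr)
  define c where "c = cdot w (A *v v)"
  define q where "q = Re (quad_form A w)"
  assume "cdot w (A *v v) \<noteq> 0"
  then have c: "0 < (cmod c)\<^sup>2" by (simp add: c_def)
  have q: "0 \<le> q" using nonneg[OF w] by (simp add: q_def)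
  \<comment> \<open>Along \<open>v - t c w\<close> the form is \<open>\<bar>c\<bar>\<^sup>2 (t\<^sup>2 q - 2 t)\<close>. It is negative for small \<open>t > 0\<close>;
      this \<open>t\<close> makes \<open>t q < 1\<close>, also when \<open>q = 0\<close>.\<close>
  define t where "t = 1 / (q + 1)"
  define s where "s = of_real t * c"
  have cvw: "cdot v (A *v w) = cnj c"
    using A by (simp add: c_def cdot_cnj cdot_hermitian)
  have "v - s *s w \<in> S"
    using S v(1) w by (simp add: vec.subspace_diff vec.subspace_scale)
  then have "0 \<le> Re (quad_form A (v - s *s w))" by (rule nonneg)
  also have "quad_form A (v - s *s w)
      = quad_form A v - cnj s * c - s * cnj c + of_real ((cmod s)\<^sup>2) * quad_form A w"
    by (simp add: quad_form_cdot vec.diff vec.scale cdot_linear cvw c_def[symmetric]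
        complex_norm_square algebra_simps del: of_real_power)
  also have "Re \<dots> = - 2 * t * (cmod c)\<^sup>2 + t\<^sup>2 * (cmod c)\<^sup>2 * q"
  proof -
    have "cnj s * c = of_real (t * (cmod c)\<^sup>2)" "s * cnj c = of_real (t * (cmod c)\<^sup>2)"
      unfolding of_real_mult complex_norm_square by (simp_all add: s_def mult_ac)
    moreover have "(cmod s)\<^sup>2 = t\<^sup>2 * (cmod c)\<^sup>2"
      by (simp add: s_def norm_mult power_mult_distrib)
    ultimately show ?thesis using v(2) by (simp add: q_def)
  qed
  also have "\<dots> = t * (cmod c)\<^sup>2 * (t * q - 2)"
    by (simp add: power2_eq_square algebra_simps)
  also have "\<dots> < 0"
  proof -
    have "0 < t" "t * q < 2" using q by (simp_all add: t_def field_simps)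
    then show ?thesis using c by (simp add: mult_pos_neg)
  qed
  finally show False by simp
qed

lemma psd_isotropic_kernel:
  assumes "A \<in> psd_cone" "Re (quad_form A x) = 0"
  shows "A *v x = 0"
proof -
  have "cdot (A *v x) (A *v x) = 0"
    by (rule isotropic_vector_orthogonal[where S = UNIV])
      (use assms in \<open>auto simp: psd_cone_def\<close>)
  then show ?thesis by (simp add: cdot_self_eq_0)
qed

section \<open>Generalised eigenvectors\<close>

lemma continuous_on_quad_form: "continuous_on S (\<lambda>x. Re (quad_form A x))"
  unfolding quad_form_def matrix_vector_mult_def by (simp, intro continuous_intros)

lemma closed_kernel: "closed {x :: complex^'n. A *v x = 0}"
proof -
  have "{x. A *v x = 0} = (\<Inter>i. {x. (\<Sum>j\<in>UNIV. A $ i $ j * x $ j) = 0})"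
    by (auto simp: vec_eq_iff matrix_vector_mult_def)
  also have "closed \<dots>"
    by (intro closed_INT ballI closed_Collect_eq continuous_intros)
  finally show ?thesis .
qed

text \<open>
  The minimum \<open>l\<close> of the Rayleigh quotient on a nonzero subspace is attained, by compactness of the
  unit sphere. Then \<open>X - l Y\<close> is nonnegative on the subspace and isotropic at a minimiser \<open>v\<close>, so
  \<open>(X - l Y) v\<close> is orthogonal to the subspace. The subspace is a kernel because it is
  used for orthogonality constraints.
\<close>

lemma rayleigh_minimiser:
  fixes X Y :: "complex^'n^'n" and A :: "complex^'n^'m"
  assumes X: "hermitian X" and Y: "pos_def Y" and x0: "A *v x0 = 0" "x0 \<noteq> 0"
  obtains v and l :: real where "A *v v = 0" "v \<noteq> 0"
    "\<And>w. A *v w = 0 \<Longrightarrow> cdot w (X *v v - of_real l *s (Y *v v)) = 0"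
proof -
  define S where "S = {x. A *v x = 0}"
  have S: "vec.subspace S"
    unfolding S_def by (auto simp: vec.subspace_def vec.add vec.scale)
  define K where "K = S \<inter> sphere 0 1"
  define R where "R x = Re (quad_form X x) / Re (quad_form Y x)" for x
  have normalise: "of_real (inverse (norm x)) *s x \<in> K" if "x \<in> S" "x \<noteq> 0" for x :: "complex^'n"
  proof -
    have "of_real (inverse (norm x)) *s x = inverse (norm x) *\<^sub>R x"
      by (simp add: vec_eq_iff scaleR_conv_of_real[where 'a = complex])
    then have "norm (of_real (inverse (norm x)) *s x) = 1" using that by simp
    then show ?thesis using that S by (simp add: K_def vec.subspace_scale)
  qed
  have K0: "x \<noteq> 0" if "x \<in> K" for x using that by (auto simp: K_def)
  have Y_pos: "0 < Re (quad_form Y x)" if "x \<noteq> 0" for x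
    using Y that by (simp add: pos_def_def)
  have "compact K"
    unfolding K_def S_def by (intro closed_Int_compact closed_kernel compact_sphere)
  moreover have "K \<noteq> {}" using normalise[of x0] x0 by (auto simp: S_def)
  moreover have "continuous_on K R"
    unfolding R_def
    by (intro continuous_on_divide continuous_on_quad_form ballI) (use Y_pos K0 in force)
  ultimately obtain v where v: "v \<in> K" and min: "\<And>x. x \<in> K \<Longrightarrow> R v \<le> R x"
    using continuous_attains_inf[of K R] by blast
  define B where "B = X - R v *\<^sub>R Y"
  have "v \<noteq> 0" using v K0 by blast
  have B: "hermitian B"
    using X Y by (simp add: B_def hermitian_diff pos_def_def)
  have Bq: "Re (quad_form B x) = Re (quad_form X x) - R v * Re (quad_form Y x)" for x
    by (simp add: B_def quad_form_diff)
  have nonneg: "0 \<le> Re (quad_form B x)" if "x \<in> S" for x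
  proof (cases "x = 0")
    case True
    then show ?thesis by (simp add: quad_form_cdot cdot_linear)
  next
    case False
    define c where "c = (cmod (of_real (inverse (norm x))))\<^sup>2"
    have c: "0 < c" using False by (simp add: c_def)
    have "R v \<le> R (of_real (inverse (norm x)) *s x)" using normalise that False min by blast
    also have "\<dots> = (c * Re (quad_form X x)) / (c * Re (quad_form Y x))"
      unfolding R_def quad_form_scale c_def[symmetric] by simp
    also have "\<dots> = R x" using c by (simp add: R_def)
    finally show ?thesis using Y_pos[OF False] by (simp add: Bq R_def field_simps)
  qed
  have "Re (quad_form B v) = 0" using Y_pos[OF \<open>v \<noteq> 0\<close>] by (simp add: Bq R_def)
  then have orth: "cdot w (B *v v) = 0" if "w \<in> S" for w
    using isotropic_vector_orthogonal[OF B S nonneg _ _ that] v by (auto simp: K_def)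
  have "B *v v = X *v v - of_real (R v) *s (Y *v v)"
    by (simp add: B_def vec_eq_iff matrix_vector_mult_def scaleR_conv_of_real[where 'a = complex] sum_subtractf
        sum_distrib_left algebra_simps)
  then show thesis
    using that[of v "R v"] v \<open>v \<noteq> 0\<close> orth by (auto simp: K_def S_def)
qed

text \<open>
  Vectors are indexed by a set \<open>I\<close> of coordinates, rather than by an initial segment
  of the naturals, for two reasons. The orthogonality constraints against the
  vectors already found form a square matrix whose rows outside \<open>I\<close> are zero, hence a singular one,
  so a further vector satisfying them exists without any dimension count. And at
  \<open>I = UNIV\<close> the vectors are the columns of a square matrix.
\<close>

lemma generalised_eigenvectors:
  fixes X Y :: "complex^'n^'n"
  assumes X: "hermitian X" and Y: "pos_def Y" and I: "finite (I :: 'n set)"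
  shows "\<exists>(v :: 'n \<Rightarrow> complex^'n) (l :: 'n \<Rightarrow> real).
    (\<forall>i\<in>I. X *v v i = of_real (l i) *s (Y *v v i)) \<and>
    (\<forall>i\<in>I. \<forall>j\<in>I. cdot (v i) (Y *v v j) = (if i = j then 1 else 0))"
  using I
proof induction
  case empty
  then show ?case by simp
next
  case (insert k I)
  then obtain v :: "'n \<Rightarrow> complex^'n" and l :: "'n \<Rightarrow> real"
    where eig: "\<And>i. i \<in> I \<Longrightarrow> X *v v i = of_real (l i) *s (Y *v v i)"
      and orth: "\<And>i j. i \<in> I \<Longrightarrow> j \<in> I \<Longrightarrow> cdot (v i) (Y *v v j) = (if i = j then 1 else 0)"
    by blast
  have Yh: "hermitian Y" using Y by (simp add: pos_def_def)
  define A :: "complex^'n^'n" where "A = (\<chi> i j. if i \<in> I then cnj ((Y *v v i) $ j) else 0)"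
  have A_row: "(A *v x) $ i = (if i \<in> I then cdot (v i) (Y *v x) else 0)" for x i
  proof -
    have "(A *v x) $ i = (if i \<in> I then cdot (Y *v v i) x else 0)"
      by (simp add: A_def matrix_vector_mult_def[of "vec_lambda _"] cdot_def)
    then show ?thesis by (simp add: cdot_hermitian[OF Yh])
  qed
  have A_ker: "A *v x = 0 \<longleftrightarrow> (\<forall>i\<in>I. cdot (v i) (Y *v x) = 0)" for x
    by (auto simp: vec_eq_iff A_row)
  have "row k A = 0" using \<open>k \<notin> I\<close> by (simp add: A_def row_def vec_eq_iff)
  then have "det A = 0" by (rule det_zero_row)
  then have "\<not> invertible A" by (simp add: invertible_det_nz)
  then obtain x0 where "A *v x0 = 0" "x0 \<noteq> 0"
    by (auto simp: invertible_left_inverse matrix_left_invertible_ker)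
  then obtain u m where u: "A *v u = 0" "u \<noteq> 0"
    and crit: "\<And>w. A *v w = 0 \<Longrightarrow> cdot w (X *v u - of_real m *s (Y *v u)) = 0"
    using rayleigh_minimiser[OF X Y] by metis
  \<comment> \<open>The residual \<open>r\<close> is orthogonal to all constrained vectors, and also to the \<open>v i\<close>. The second
      fact says that \<open>w = Y\<^sup>-\<^sup>1 r\<close> is itself constrained, so \<open>w\<^sup>* Y w = w\<^sup>* r = 0\<close> and \<open>r = Y w = 0\<close>.\<close>
  define r where "r = X *v u - of_real m *s (Y *v u)"
  define w where "w = matrix_inv Y *v r"
  have Yw: "Y *v w = r"
    by (simp add: w_def matrix_vector_mul_assoc matrix_inv_mult pos_def_invertible[OF Y])
  have "cdot (v i) r = 0" if "i \<in> I" for i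
  proof -
    have "cdot (v i) (X *v u) = of_real (l i) * cdot (v i) (Y *v u)"
      using eig[OF that] X Yh by (simp add: cdot_hermitian[symmetric] cdot_linear)
    moreover have "cdot (v i) (Y *v u) = 0" using u A_ker that by blast
    ultimately show ?thesis by (simp add: r_def cdot_linear)
  qed
  then have "A *v w = 0" by (simp add: A_ker Yw)
  then have "quad_form Y w = 0" using crit by (simp add: quad_form_cdot Yw r_def)
  then have "w = 0" using Y by (force simp: pos_def_def)
  then have u_eig: "X *v u = of_real m *s (Y *v u)" using Yw by (simp add: r_def)
  define d where "d = Re (quad_form Y u)"
  have d: "0 < d" using Y u by (simp add: d_def pos_def_def)
  define z where "z = of_real (1 / sqrt d) *s u"
  have z_eig: "X *v z = of_real m *s (Y *v z)"
    by (simp add: z_def vec.scale u_eig mult.commute)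
  have "quad_form Y z = of_real (1 / d) * quad_form Y u"
    using d by (simp add: z_def quad_form_scale norm_divide power_divide)
  also have "quad_form Y u = of_real d"
    unfolding d_def by (rule quad_form_real[OF Yh])
  finally have z_unit: "cdot z (Y *v z) = 1" using d by (simp add: quad_form_cdot)
  have vz: "cdot (v i) (Y *v z) = 0" if "i \<in> I" for i
    using u A_ker that by (simp add: z_def vec.scale cdot_linear)
  have zv: "cdot z (Y *v v i) = 0" if "i \<in> I" for i
    using vz[OF that] cdot_cnj[of "v i" "Y *v z"] by (simp add: cdot_hermitian[OF Yh])
  show ?case
    by (rule exI[of _ "v(k := z)"], rule exI[of _ "l(k := m)"])
      (use insert.hyps in \<open>auto simp: eig orth z_eig z_unit vz zv\<close>)
qed

text \<open>
  For the matrix \<open>P\<close> of generalised eigenvectors, orthonormality reads \<open>P\<^sup>* Y P = 1\<close>, which makes \<open>P\<^sup>*\<close>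
  the inverse of \<open>Q = Y P\<close>. The eigenvalue equations read \<open>X P = Q L\<close>, that is \<open>X Y\<^sup>-\<^sup>1 Q = Q L\<close>
  because \<open>P = Y\<^sup>-\<^sup>1 Q\<close>.
\<close>

lemma pos_def_quotient_diagonalisation:
  fixes X Y :: "complex^'n^'n"
  assumes X: "pos_def X" and Y: "pos_def Y"
  obtains Q P' and l :: "'n \<Rightarrow> real" where "\<And>i. 0 < l i" "P' ** Q = mat 1"
    "X ** matrix_inv Y = Q ** (\<chi> i j. if i = j then of_real (l i) else 0) ** P'"
proof -
  have Xh: "hermitian X" and Yh: "hermitian Y" using X Y by (simp_all add: pos_def_def)
  obtain v :: "'n \<Rightarrow> complex^'n" and l :: "'n \<Rightarrow> real"
    where eig: "\<And>i. X *v v i = of_real (l i) *s (Y *v v i)"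
      and orth: "\<And>i j. cdot (v i) (Y *v v j) = (if i = j then 1 else 0)"
    using generalised_eigenvectors[OF Xh Y finite_class.finite_UNIV] by auto
  define P :: "complex^'n^'n" where "P = (\<chi> a i. v i $ a)"
  define L :: "complex^'n^'n" where "L = (\<chi> i j. if i = j then of_real (l i) else 0)"
  have col: "(B ** P) $ a $ i = (B *v v i) $ a" for B :: "complex^'n^'n" and a i
    by (simp add: P_def matrix_matrix_mult_def matrix_vector_mult_def)
  have PQ: "conj_transpose P ** (Y ** P) = mat 1"
  proof -
    have "(conj_transpose P ** B) $ i $ j = (\<Sum>a\<in>UNIV. cnj (v i $ a) * B $ a $ j)"
      for B :: "complex^'n^'n" and i j
      by (simp add: matrix_matrix_mult_def conj_transpose_def P_def)
    then show ?thesis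
      by (simp add: col vec_eq_iff mat_def orth[symmetric] cdot_def)
  qed
  have "(B ** L) $ a $ i = of_real (l i) * B $ a $ i" for B :: "complex^'n^'n" and a i
    by (simp add: matrix_matrix_mult_def L_def if_distrib cong: if_cong)
  then have XP: "X ** P = Y ** P ** L"
    by (simp add: vec_eq_iff col eig)
  have "X ** matrix_inv Y = X ** matrix_inv Y ** ((Y ** P) ** conj_transpose P)"
    using PQ by (simp add: matrix_left_right_inverse[of "conj_transpose P"])
  also have "\<dots> = X ** (matrix_inv Y ** Y) ** P ** conj_transpose P"
    by (simp add: matrix_mul_assoc)
  also have "\<dots> = (Y ** P) ** L ** conj_transpose P"
    by (simp add: matrix_inv_mult pos_def_invertible[OF Y] XP)
  finally have fact: "X ** matrix_inv Y = (Y ** P) ** L ** conj_transpose P" .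
  have "0 < l i" for i
  proof -
    have "quad_form X (v i) = of_real (l i)"
      by (simp add: quad_form_cdot eig cdot_linear orth)
    moreover have "v i \<noteq> 0" using orth[of i i] by (auto simp: cdot_linear)
    ultimately show ?thesis using X by (force simp: pos_def_def)
  qed
  with that PQ fact show thesis unfolding L_def by blast
qed

section \<open>The log determinant divergence\<close>

text \<open>
  Trace and determinant are invariant under similarity, so the divergence reduces to the
  scalar inequality \<open>ln t \<le> t - 1\<close> for each of the \<open>l i\<close>.
\<close>

lemma ld_div_nonneg:
  fixes X Y :: "complex^'n^'n"
  assumes Y: "pos_def Y"
  shows "0 \<le> ld_div X Y"
proof (cases "pos_def X")
  case True
  obtain Q P' and l :: "'n \<Rightarrow> real" where l: "\<And>i. 0 < l i" and inv: "P' ** Q = mat 1"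
    and fact: "X ** matrix_inv Y = Q ** (\<chi> i j. if i = j then of_real (l i) else 0) ** P'"
    using pos_def_quotient_diagonalisation[OF True Y] by blast
  define L :: "complex^'n^'n" where "L = (\<chi> i j. if i = j then of_real (l i) else 0)"
  note fact = fact[folded L_def]
  have "trace (X ** matrix_inv Y) = trace (P' ** (Q ** L))"
    unfolding fact by (rule trace_mul_sym)
  also have "\<dots> = of_real (\<Sum>i\<in>UNIV. l i)"
    by (simp add: matrix_mul_assoc inv trace_def L_def)
  finally have tr: "Re (trace (X ** matrix_inv Y)) = (\<Sum>i\<in>UNIV. l i)" by simp
  have "det (X ** matrix_inv Y) = det (P' ** Q) * det L"
    by (simp add: fact det_mul mult_ac)
  also have "\<dots> = of_real (\<Prod>i\<in>UNIV. l i)"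
    by (simp add: inv) (subst det_diagonal; simp add: L_def)
  finally have "Re (det (X ** matrix_inv Y)) = (\<Prod>i\<in>UNIV. l i)"
    by (simp only: Re_complex_of_real)
  then have dt: "ln (Re (det (X ** matrix_inv Y))) = (\<Sum>i\<in>UNIV. ln (l i))"
    using ln_prod[of UNIV l] l by (simp add: less_imp_neq[symmetric])
  have "(\<Sum>i\<in>UNIV. ln (l i)) \<le> (\<Sum>i\<in>UNIV. l i - 1)"
    using l by (intro sum_mono ln_le_minus_one)
  then show ?thesis using True by (simp add: ld_div_def tr dt sum_subtractf)
qed (simp add: ld_div_def)

lemma ld_div_self:
  fixes Y :: "complex^'n^'n"
  assumes "pos_def Y" shows "ld_div Y Y = 0"
  using assms by (simp add: ld_div_def matrix_inv_mult pos_def_invertible trace_I)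

section \<open>The Nystroem approximation\<close>

lemma full_rank_kernel_trivial:
  fixes A :: "'a::field^'n^'m"
  assumes "full_rank A" "CARD('n) \<le> CARD('m)" "A *v x = 0"
  shows "x = 0"
proof -
  have "vec.dim (rows A) = CARD('n)" using assms by (simp add: full_rank_def row_rank_def_gen)
  then have "vec.span (rows A) = UNIV"
    by (metis vec.dim_eq_full vec.dimension_def card_cart_basis)
  then show ?thesis
    using assms(3) matrix_left_invertible_span_rows_gen[of A] matrix_left_invertible_ker[of A] by blast
qed

lemma pinv_invertible:
  assumes "invertible (A :: complex^'n^'n)" shows "pinv A = matrix_inv A"
  by (rule pinv_eqI) (simp add: is_pinv_def matrix_inv_mult[OF assms] hermitian_def)

lemma compression_pos_def:
  fixes H :: "complex^'n^'n" and \<Omega> :: "complex^'r^'n"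
  assumes H: "H \<in> psd_cone" and inj: "\<And>x. (H ** \<Omega>) *v x = 0 \<Longrightarrow> x = 0"
  shows "pos_def (conj_transpose \<Omega> ** H ** \<Omega>)"
proof -
  have M: "conj_transpose \<Omega> ** H ** \<Omega> \<in> psd_cone" by (rule psd_cone_congruence[OF H])
  have "Re (quad_form (conj_transpose \<Omega> ** H ** \<Omega>) x) \<noteq> 0" if "x \<noteq> 0" for x
    using psd_isotropic_kernel[OF H, of "\<Omega> *v x"] inj[of x] that
    by (auto simp: quad_form_congruence matrix_vector_mul_assoc)
  then show ?thesis using M by (force simp: psd_cone_def pos_def_def less_le)
qed

text \<open>
  The approximation is congruent, through \<open>(H \<Omega>)\<^sup>*\<close>, to the inverse of \<open>\<Omega>\<^sup>* H \<Omega>\<close>.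
\<close>

lemma nystrom_psd:
  assumes "pos_def (conj_transpose \<Omega> ** H ** \<Omega>)"
  shows "nystrom H \<Omega> \<in> psd_cone"
  using psd_cone_congruence[OF psd_cone_matrix_inv[OF assms], of "conj_transpose (H ** \<Omega>)"]
  by (simp add: nystrom_def pinv_invertible[OF pos_def_invertible[OF assms]])

lemma nystrom_compression:
  assumes H: "hermitian H" and "pos_def (conj_transpose \<Omega> ** H ** \<Omega>)"
  shows "conj_transpose \<Omega> ** nystrom H \<Omega> ** \<Omega> = conj_transpose \<Omega> ** H ** \<Omega>"
proof -
  define M where "M = conj_transpose \<Omega> ** H ** \<Omega>"
  have M: "invertible M" using assms by (simp add: M_def pos_def_invertible)
  have "conj_transpose \<Omega> ** nystrom H \<Omega> ** \<Omega> = M ** matrix_inv M ** M"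
    using H by (simp add: nystrom_def M_def[symmetric] pinv_invertible[OF M])
      (simp add: M_def hermitian_def conj_transpose_mult matrix_mul_assoc)
  also have "\<dots> = M" by (simp add: matrix_inv_mult[OF M])
  finally show ?thesis by (simp add: M_def)
qed

lemma nystrom_range: "range ((*v) (nystrom H \<Omega>)) \<subseteq> range ((*v) (H ** \<Omega>))"
proof -
  have "nystrom H \<Omega> *v x
      = (H ** \<Omega>) *v (pinv (conj_transpose \<Omega> ** H ** \<Omega>) *v (conj_transpose (H ** \<Omega>) *v x))" for x
    by (simp add: nystrom_def matrix_vector_mul_assoc matrix_mul_assoc)
  then show ?thesis by auto
qed

theorem proposition5:
  fixes H :: "complex^'n^'n" and \<Omega> :: "real^'r^'n"
  assumes "H \<in> psd_cone"
    and "CARD('r) \<le> CARD('n)"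
    and "full_rank \<Omega>"
    and "full_rank (H ** complex_matrix \<Omega>)"
  shows "is_arg_min
           (\<lambda>W. ld_div (conj_transpose (complex_matrix \<Omega>) ** W ** complex_matrix \<Omega>)
                       (conj_transpose (complex_matrix \<Omega>) ** H ** complex_matrix \<Omega>))
           (\<lambda>W. W \<in> psd_cone \<and> range ((*v) W) \<subseteq> range ((*v) (H ** complex_matrix \<Omega>)))
           (nystrom H (complex_matrix \<Omega>))"
proof -
  have M: "pos_def (conj_transpose (complex_matrix \<Omega>) ** H ** complex_matrix \<Omega>)"
    using assms(1) full_rank_kernel_trivial[OF assms(4,2)] by (rule compression_pos_def)
  have "hermitian H" using assms(1) by (simp add: psd_cone_def)
  then show ?thesis
    unfolding is_arg_min_def nystrom_compression[OF \<open>hermitian H\<close> M] ld_div_self[OF M]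
    using nystrom_psd[OF M] nystrom_range[of H "complex_matrix \<Omega>"] ld_div_nonneg[OF M]
    by (simp add: not_less)
qed

end
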